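(* Let $X$ and $Y$ be real locally convex Hausdorff topological vector spaces with topological duals $X^{\ast}$ and $Y^{\ast}$, $F\colon X\times Y\to\overline{\mathbb{R}}=\mathbb{R}\cup\{\pm\infty\}$ a function, and $h\colon X\to\overline{\mathbb{R}}$ a proper convex lower semicontinuous function. Assume that for every $a'\in\operatorname{dom}h^{\ast}$, $$\inf_{x\in X}\left(F(x,0_{Y})-\langle a',x\rangle\right)=\inf_{x\in X}\left(F^{\ast\ast}(x,0_{Y})-\langle a',x\rangle\right)\neq+\infty,$$ and that the set $$\left\{(x',s)\in X^{\ast}\times\mathbb{R}:\exists\mu\in Y^{\ast},\ F^{\ast}(x',\mu)\leq s\right\}$$ is weak*-closed regarding $\operatorname{gph}h^{\ast}$. Then the $S^{h}_{F}$-procedure is valid.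
   Context: $X^{\ast}$ and $X^{\ast}\times\mathbb{R}$ carry the weak*-topology; $\langle\cdot,\cdot\rangle$ denotes the duality products; $0_{Y}$ is the null vector of $Y$. Fenchel conjugates: $h^{\ast}(a')=\sup_{x\in X}\{\langle a',x\rangle-h(x)\}$, $\operatorname{dom}h^{\ast}=\{a'\in X^{\ast}:h^{\ast}(a')<+\infty\}$, $\operatorname{gph}h^{\ast}=\{(a',h^{\ast}(a')):a'\in\operatorname{dom}h^{\ast}\}$. Also $F^{\ast}(x',\mu)=\sup_{(x,y)\in X\times Y}\{\langle x',x\rangle+\langle\mu,y\rangle-F(x,y)\}$ for $(x',\mu)\in X^{\ast}\times Y^{\ast}$, and $F^{\ast\ast}(x,y)=\sup_{(x',\mu)\in X^{\ast}\times Y^{\ast}}\{\langle x',x\rangle+\langle\mu,y\rangle-F^{\ast}(x',\mu)\}$ for $(x,y)\in X\times Y$. The $S^{h}_{F}$-procedure concerns the two statements $(\mathbb{A}_{h})$: $F(x,0_{Y})\geq h(x)$ for all $x\in X$; $(\mathbb{B}_{h})$: for every $a'\in\operatorname{dom}h^{\ast}$ there exists $\mu\in Y^{\ast}$ such that $F^{\ast}(a',\mu)\leq h^{\ast}(a')$. One always has $(\mathbb{B}_{h})\Rightarrow(\mathbb{A}_{h})$. The procedure is said to be valid if $(\mathbb{A}_{h})\Leftrightarrow(\mathbb{B}_{h})$ or, equivalently, $(\mathbb{A}_{h})\Rightarrow(\mathbb{B}_{h})$. A subset $C$ of a locally convex space is closed regarding a subset $D$ of the same space if $\overline{C}\cap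 D=C\cap D$; "weak*-closed regarding" means that the closure is taken in the weak*-topology. *)

theory Defs
  imports "HOL-Analysis.Analysis"
begin

text \<open>The second axiom spells out the body of \<^const>\<open>convex\<close>, which cannot itself occur in a class
  specification because of its sort constraint; see \<open>locally_convex\<close> below.\<close>

class locally_convex_t2_space = real_vector + topological_ab_group_add + t2_space +
  assumes tendsto_scaleR_Pair:
    "LIM z (nhds c \<times>\<^sub>F nhds x). fst z *\<^sub>R snd z :> nhds (c *\<^sub>R x)"
  and locally_convex_explicit:
    "open U \<Longrightarrow> x \<in> U \<Longrightarrow> \<exists>V. open V \<and> x \<in> V \<and> V \<subseteq> U \<and>
      (\<forall>y\<in>V. \<forall>z\<in>V. \<forall>u\<ge>0. \<forall>v\<ge>0. u + v = 1 \<longrightarrow> u *\<^sub>R y + v *\<^sub>R z \<in> V)"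

lemma locally_convex:
  fixes U :: "'a::locally_convex_t2_space set"
  assumes "open U" "x \<in> U"
  shows "\<exists>V. open V \<and> convex V \<and> x \<in> V \<and> V \<subseteq> U"
  using locally_convex_explicit[OF assms] unfolding convex_def by blast

instance real_normed_vector \<subseteq> locally_convex_t2_space
proof
  fix c :: real and x :: 'a
  show "LIM z (nhds c \<times>\<^sub>F nhds x). fst z *\<^sub>R snd z :> nhds (c *\<^sub>R x)"
    by (intro tendsto_scaleR filterlim_fst filterlim_snd)
next
  fix U :: "'a set" and x
  assume "open U" "x \<in> U"
  then obtain e where "e > 0" "ball x e \<subseteq> U"
    by (auto simp: open_contains_ball)
  then show "\<exists>V. open V \<and> x \<in> V \<and> V \<subseteq> U \<and>
      (\<forall>y\<in>V. \<forall>z\<in>V. \<forall>u\<ge>0. \<forall>v\<ge>0. u + v = 1 \<longrightarrow> u *\<^sub>R y + v *\<^sub>R z \<in> V)"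
    using convex_ball[of x e] by (intro exI[of _ "ball x e"]) (auto simp: convex_def)
qed

definition topological_dual :: "('a::locally_convex_t2_space \<Rightarrow> real) set" where
  "topological_dual = {f. linear f \<and> continuous_on UNIV f}"

definition weak_star :: "('a::locally_convex_t2_space \<Rightarrow> real) topology" where
  "weak_star = subtopology (powertop_real UNIV) topological_dual"

lemma topspace_weak_star [simp]: "topspace weak_star = topological_dual"
  by (simp add: weak_star_def)

text \<open>The topology above is the initial topology with respect to the evaluation maps.\<close>

lemma continuous_map_into_weak_star:
  "continuous_map T weak_star g \<longleftrightarrow>
    g \<in> topspace T \<rightarrow> topological_dual \<and>
    (\<forall>x. continuous_map T euclideanreal (\<lambda>t. g t x))"
  by (auto simp: weak_star_def continuous_map_in_subtopology
      continuous_map_componentwise_UNIV image_subset_iff_funcset)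

definition closed_regarding :: "'a topology \<Rightarrow> 'a set \<Rightarrow> 'a set \<Rightarrow> bool" where
  "closed_regarding T C D \<longleftrightarrow> (T closure_of C) \<inter> D = C \<inter> D"

definition proper_fun :: "('a \<Rightarrow> ereal) \<Rightarrow> bool" where
  "proper_fun h \<longleftrightarrow> (\<forall>x. h x \<noteq> -\<infinity>) \<and> (\<exists>x. h x \<noteq> \<infinity>)"

text \<open>Convexity is stated through the epigraph, so that no sum of opposite infinities occurs.\<close>

definition convex_fun :: "('a::real_vector \<Rightarrow> ereal) \<Rightarrow> bool" where
  "convex_fun h \<longleftrightarrow> convex {(x, r). h x \<le> ereal r}"

definition lsc_fun :: "('a::topological_space \<Rightarrow> ereal) \<Rightarrow> bool" where
  "lsc_fun h \<longleftrightarrow> (\<forall>x. \<forall>c < h x. \<forall>\<^sub>F y in nhds x. c < h y)"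

text \<open>In all differences below the pairing is a real number, hence they are never of the
  form \<open>\<infinity> - \<infinity>\<close>. Conjugates are meaningful for arguments in the dual only.\<close>

definition fenchel_conj :: "('a \<Rightarrow> ereal) \<Rightarrow> ('a \<Rightarrow> real) \<Rightarrow> ereal" where
  "fenchel_conj h a = (SUP x. ereal (a x) - h x)"

definition dom_conj :: "('a::locally_convex_t2_space \<Rightarrow> ereal) \<Rightarrow> ('a \<Rightarrow> real) set" where
  "dom_conj h = {a \<in> topological_dual. fenchel_conj h a < \<infinity>}"

text \<open>For proper \<open>h\<close> the conjugate never takes the value \<open>-\<infinity>\<close>, so every point of its
  domain contributes exactly one point to the graph.\<close>

definition gph_conj :: "('a::locally_convex_t2_space \<Rightarrow> ereal) \<Rightarrow> (('a \<Rightarrow> real) \<times> real) set" where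
  "gph_conj h = {(a, s). a \<in> dom_conj h \<and> fenchel_conj h a = ereal s}"

text \<open>The dual of \<open>X \<times> Y\<close> is represented by pairs of functionals.\<close>

definition fenchel_conj2 ::
  "('a \<times> 'b \<Rightarrow> ereal) \<Rightarrow> ('a \<Rightarrow> real) \<times> ('b \<Rightarrow> real) \<Rightarrow> ereal" where
  "fenchel_conj2 F = (\<lambda>(a, m). SUP (x, y). ereal (a x + m y) - F (x, y))"

definition fenchel_biconj2 ::
  "('a::locally_convex_t2_space \<times> 'b::locally_convex_t2_space \<Rightarrow> ereal) \<Rightarrow> 'a \<times> 'b \<Rightarrow> ereal" where
  "fenchel_biconj2 F = (\<lambda>(x, y).
     SUP (a, m) \<in> topological_dual \<times> topological_dual. ereal (a x + m y) - fenchel_conj2 F (a, m))"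

definition S_statement_A :: "('a \<times> 'b::zero \<Rightarrow> ereal) \<Rightarrow> ('a \<Rightarrow> ereal) \<Rightarrow> bool" where
  "S_statement_A F h \<longleftrightarrow> (\<forall>x. F (x, 0) \<ge> h x)"

definition S_statement_B ::
  "('a::locally_convex_t2_space \<times> 'b::locally_convex_t2_space \<Rightarrow> ereal) \<Rightarrow> ('a \<Rightarrow> ereal) \<Rightarrow> bool" where
  "S_statement_B F h \<longleftrightarrow>
     (\<forall>a \<in> dom_conj h. \<exists>m \<in> topological_dual. fenchel_conj2 F (a, m) \<le> fenchel_conj h a)"

definition S_procedure_valid ::
  "('a::locally_convex_t2_space \<times> 'b::locally_convex_t2_space \<Rightarrow> ereal) \<Rightarrow> ('a \<Rightarrow> ereal) \<Rightarrow> bool" where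
  "S_procedure_valid F h \<longleftrightarrow> (S_statement_A F h \<longleftrightarrow> S_statement_B F h)"

end

(*
  (B) implies (A): every real c < h x is exceeded by an affine minorant a - h^*(a) of h at x
  (Fenchel-Moreau), and (B) turns each of these into a minorant of F(., 0).

  (A) implies (B): let a be in dom h^* and s = h^*(a). By (A) and the equality of the two infima,
  F^**(., 0) >= a - s. If (a, s) were outside the weak*-closure of the convex projected epigraph C,
  finitely many evaluations would separate it from C; that is, some z in X, b and kappa satisfy
  a'(z) + b s' <= kappa < a(z) + b s on C. As C is upward closed, b <= 0. For b < 0 this bounds
  F^** at (-z/b, 0) below a(-z/b) - s. For b = 0 it makes F^**(., 0) - a tend to -infinity along
  x0 + t z, starting from a point x0 where F^**(x0, 0) < infinity.
*)

theory Submission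
  imports Defs "HOL-Library.Function_Algebras"
begin

section \<open>Sublinear functionals\<close>

definition sublinear :: "('a::real_vector \<Rightarrow> real) \<Rightarrow> bool" where
  "sublinear p \<longleftrightarrow> (\<forall>x y. p (x + y) \<le> p x + p y) \<and> (\<forall>c>0. \<forall>x. p (c *\<^sub>R x) = c * p x)"

lemma sublinear_add: "sublinear p \<Longrightarrow> p (x + y) \<le> p x + p y"
  by (simp add: sublinear_def)

lemma sublinear_scaleR_pos: "sublinear p \<Longrightarrow> c > 0 \<Longrightarrow> p (c *\<^sub>R x) = c * p x"
  by (simp add: sublinear_def)

lemma sublinear_zero: "sublinear p \<Longrightarrow> p 0 = 0"
  using sublinear_scaleR_pos[of p 2 0] by simp

lemma sublinear_scaleR: "sublinear p \<Longrightarrow> c \<ge> 0 \<Longrightarrow> p (c *\<^sub>R x) = c * p x"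
  by (cases "c = 0") (auto simp: sublinear_scaleR_pos sublinear_zero)

lemma sublinear_minus: "sublinear p \<Longrightarrow> - p (- x) \<le> p x"
  using sublinear_add[of p x "- x"] sublinear_zero[of p] by simp

text \<open>For functionals defined as infima only one half of homogeneity is immediate; the other
  half is the same inequality for \<open>1 / c\<close> at the point
  \<open>c *\<^sub>R x\<close>.\<close>

lemma sublinearI:
  assumes "\<And>x y. p (x + y) \<le> p x + p y" and "\<And>c x. c > 0 \<Longrightarrow> p (c *\<^sub>R x) \<le> c * p x"
  shows "sublinear p"
proof -
  have "p (c *\<^sub>R x) = c * p x" if "c > 0" for c x
  proof (rule antisym)
    have "p ((1 / c) *\<^sub>R (c *\<^sub>R x)) \<le> (1 / c) * p (c *\<^sub>R x)"
      using that by (intro assms) simp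
    then show "c * p x \<le> p (c *\<^sub>R x)"
      using that by (simp add: field_simps)
  qed (use assms that in blast)
  then show ?thesis using assms(1) by (simp add: sublinear_def)
qed

text \<open>The descent step of Hahn-Banach: \<open>q x\<close> is the infimum of
  \<open>p (x + t *\<^sub>R z) - t * p z\<close> over t \<ge> 0. Taking t = 0 gives
  \<open>q \<le> p\<close>; taking t = 1 at \<open>- z\<close> gives the last bound.\<close>

lemma sublinear_shift:
  fixes p :: "'a::real_vector \<Rightarrow> real"
  assumes p: "sublinear p"
  obtains q where "sublinear q" "q \<le> p" "q (- z) \<le> - p z"
proof -
  define A where "A x = (\<lambda>t. p (x + t *\<^sub>R z) - t * p z) ` {0..}" for x
  define q where "q x = Inf (A x)" for x
  \<comment> \<open>Subadditivity on t z = (x + t z) + (- x) bounds all candidates from below, so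
    the infimum is finite.\<close>
  have lower: "- p (- x) \<le> y" if y: "y \<in> A x" for x y
  proof -
    obtain t where t: "t \<ge> 0" "y = p (x + t *\<^sub>R z) - t * p z"
      using y by (auto simp: A_def)
    show ?thesis
      using sublinear_add[OF p, of "x + t *\<^sub>R z" "- x"] sublinear_scaleR[OF p t(1), of z] t(2)
      by simp
  qed
  have bdd: "bdd_below (A x)" for x
    using lower by (intro bdd_belowI)
  have ne: "A x \<noteq> {}" for x by (auto simp: A_def)
  have upper: "q x \<le> p (x + t *\<^sub>R z) - t * p z" if "t \<ge> 0" for x t
    unfolding q_def using bdd that by (intro cInf_lower) (auto simp: A_def)
  have greatest: "m \<le> q x" if "\<And>t. t \<ge> 0 \<Longrightarrow> m \<le> p (x + t *\<^sub>R z) - t * p z" for m x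
    unfolding q_def using ne that by (intro cInf_greatest) (auto simp: A_def)
  have "sublinear q"
  proof (rule sublinearI)
    fix x y
    \<comment> \<open>The two infima are taken in turn: first over t with u fixed, then over
      u.\<close>
    have "q (x + y) - (p (y + u *\<^sub>R z) - u * p z) \<le> q x" if "u \<ge> 0" for u
    proof (rule greatest)
      fix t :: real assume "t \<ge> 0"
      then have "q (x + y) \<le> p (x + y + (t + u) *\<^sub>R z) - (t + u) * p z"
        using that by (intro upper) simp
      also have "x + y + (t + u) *\<^sub>R z = (x + t *\<^sub>R z) + (y + u *\<^sub>R z)"
        by (simp add: algebra_simps)
      finally show "q (x + y) - (p (y + u *\<^sub>R z) - u * p z) \<le> p (x + t *\<^sub>R z) - t * p z"
        using sublinear_add[OF p, of "x + t *\<^sub>R z" "y + u *\<^sub>R z"] by (simp add: algebra_simps)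
    qed
    then have "q (x + y) - q x \<le> q y"
      by (intro greatest) (simp add: algebra_simps)
    then show "q (x + y) \<le> q x + q y" by simp
  next
    fix c :: real and x
    assume c: "c > 0"
    have "q (c *\<^sub>R x) / c \<le> q x"
    proof (rule greatest)
      fix t :: real assume "t \<ge> 0"
      then have "q (c *\<^sub>R x) \<le> p (c *\<^sub>R x + (c * t) *\<^sub>R z) - (c * t) * p z"
        using c by (intro upper) simp
      also have "c *\<^sub>R x + (c * t) *\<^sub>R z = c *\<^sub>R (x + t *\<^sub>R z)"
        by (simp add: algebra_simps)
      also have "p (c *\<^sub>R (x + t *\<^sub>R z)) = c * p (x + t *\<^sub>R z)"
        by (rule sublinear_scaleR_pos[OF p c])
      finally show "q (c *\<^sub>R x) / c \<le> p (x + t *\<^sub>R z) - t * p z"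
        using c by (simp add: field_simps)
    qed
    then show "q (c *\<^sub>R x) \<le> c * q x" using c by (simp add: field_simps)
  qed
  moreover have "q \<le> p"
    using upper[of 0] by (auto simp: le_fun_def)
  moreover have "q (- z) \<le> - p z"
    using upper[of 1 "- z"] sublinear_zero[OF p] by simp
  ultimately show thesis by (rule that)
qed

text \<open>The pointwise infimum serves as lower bound for Zorn's lemma. The common majorant p
  keeps it finite through \<open>- p (- x) \<le> q x\<close>; subadditivity uses the chain, since
  the smaller of two members q and r is below q at x and below r at y.\<close>

lemma sublinear_Inf_chain:
  assumes ne: "C \<noteq> {}" and sub: "\<And>q. q \<in> C \<Longrightarrow> sublinear q"
    and le: "\<And>q. q \<in> C \<Longrightarrow> q \<le> p"
    and chain: "\<And>q r. q \<in> C \<Longrightarrow> r \<in> C \<Longrightarrow> q \<le> r \<or> r \<le> q"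
  obtains u :: "'a::real_vector \<Rightarrow> real" where "sublinear u" "\<And>q. q \<in> C \<Longrightarrow> u \<le> q"
proof -
  define u where "u x = (INF q\<in>C. q x)" for x
  have bdd: "bdd_below ((\<lambda>q. q x) ` C)" for x
  proof (rule bdd_belowI2)
    fix q assume "q \<in> C"
    then show "- p (- x) \<le> q x"
      using sublinear_minus[OF sub, of q x] le[of q] by (auto simp: le_fun_def dest: spec[of _ "- x"])
  qed
  have lower: "u x \<le> q x" if "q \<in> C" for q x
    unfolding u_def using bdd that by (rule cINF_lower)
  have greatest: "m \<le> u x" if "\<And>q. q \<in> C \<Longrightarrow> m \<le> q x" for m x
    unfolding u_def using ne that by (rule cINF_greatest)
  have "sublinear u"
  proof (rule sublinearI)
    fix x y
    have two: "u (x + y) \<le> q x + r y" if qr: "q \<in> C" "r \<in> C" for q r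
    proof -
      from chain[OF qr] obtain s where s: "s \<in> C" "s x \<le> q x" "s y \<le> r y"
        using qr by (auto simp: le_fun_def)
      show ?thesis
        using lower[OF s(1), of "x + y"] sublinear_add[OF sub[OF s(1)], of x y] s by linarith
    qed
    have "u (x + y) - r y \<le> u x" if "r \<in> C" for r
      using two[OF _ that] by (intro greatest) (simp add: algebra_simps)
    then have "u (x + y) - u x \<le> u y"
      by (intro greatest) (simp add: algebra_simps)
    then show "u (x + y) \<le> u x + u y" by simp
  next
    fix c :: real and x
    assume c: "c > 0"
    have "u (c *\<^sub>R x) / c \<le> u x"
      using lower[of _ "c *\<^sub>R x"] c sublinear_scaleR_pos[OF sub c]
      by (intro greatest) (fastforce simp: field_simps)
    then show "u (c *\<^sub>R x) \<le> c * u x" using c by (simp add: field_simps)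
  qed
  then show thesis using lower that by (auto simp: le_fun_def)
qed

text \<open>By \<open>sublinear_shift\<close>, a minimal sublinear functional is odd, hence linear. Minimizing below
  the shift of \<open>p\<close> by \<open>z\<close> forces the value at \<open>z\<close>.\<close>

lemma sublinear_dominates_linear:
  fixes p :: "'a::real_vector \<Rightarrow> real"
  assumes p: "sublinear p"
  obtains f where "linear f" "f \<le> p" "f z = p z"
proof -
  obtain p1 where p1: "sublinear p1" "p1 \<le> p" "p1 (- z) \<le> - p z"
    using sublinear_shift[OF p] by blast
  define A where "A = {q. sublinear q \<and> q \<le> p1}"
  \<comment> \<open>The order is reversed, so that a maximal element for \<open>R\<close> is a
    minimal sublinear functional below \<open>p1\<close>.\<close>
  define R where "R = (\<lambda>q r :: 'a \<Rightarrow> real. r \<le> q)"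
  have "\<exists>m\<in>A. \<forall>q\<in>A. R m q \<longrightarrow> q = m"
  proof (rule predicate_Zorn)
    show "partial_order_on A (relation_of R A)"
      by (rule partial_order_on_relation_ofI) (auto simp: R_def)
    fix C assume C: "C \<in> Chains (relation_of R A)"
    then have CA: "C \<subseteq> A" by (rule Chains_relation_of)
    show "\<exists>u\<in>A. \<forall>q\<in>C. R q u"
    proof (cases "C = {}")
      case True
      then show ?thesis using p1 by (auto simp: A_def)
    next
      case False
      obtain u where u: "sublinear u" "\<And>q. q \<in> C \<Longrightarrow> u \<le> q"
      proof (rule sublinear_Inf_chain[OF False])
        show "\<And>q r. q \<in> C \<Longrightarrow> r \<in> C \<Longrightarrow> q \<le> r \<or> r \<le> q"
          using C by (auto simp: Chains_def relation_of_def R_def)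
      qed (use CA in \<open>auto simp: A_def\<close>)
      moreover obtain q where "q \<in> C" using False by blast
      ultimately have "u \<in> A" using CA by (force simp: A_def intro: order_trans)
      then show ?thesis using u(2) by (auto simp: R_def)
    qed
  qed
  then obtain f where f: "sublinear f" "f \<le> p1"
    and min: "\<And>q. sublinear q \<Longrightarrow> q \<le> f \<Longrightarrow> q = f"
    by (force simp: A_def R_def intro: order_trans)
  \<comment> \<open>The shift of \<open>f\<close> by x lies below \<open>f\<close>, hence equals
    \<open>f\<close> by minimality.\<close>
  have neg: "f (- x) = - f x" for x
  proof (rule antisym)
    obtain q where q: "sublinear q" "q \<le> f" "q (- x) \<le> - f x"
      using sublinear_shift[OF f(1)] by blast
    then show "f (- x) \<le> - f x" using min[of q] by simp
    show "- f x \<le> f (- x)" using sublinear_minus[OF f(1), of "- x"] by simp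
  qed
  have "linear f"
  proof (rule linearI)
    fix x y
    have "f x \<le> f (x + y) + f (- y)" using sublinear_add[OF f(1), of "x + y" "- y"] by simp
    then show "f (x + y) = f x + f y"
      using sublinear_add[OF f(1), of x y] neg[of y] by simp
  next
    fix c :: real and x
    show "f (c *\<^sub>R x) = c *\<^sub>R f x"
      using sublinear_scaleR[OF f(1), of c x] sublinear_scaleR[OF f(1), of "- c" x]
        neg[of "c *\<^sub>R x"]
      by (cases "c \<ge> 0") auto
  qed
  moreover have "f \<le> p" using f(2) p1(2) by (rule order_trans)
  moreover have "f z = p z"
  proof (rule antisym)
    show "f z \<le> p z" using \<open>f \<le> p\<close> by (simp add: le_fun_def)
    have "f (- z) \<le> - p z" using f(2) p1(3) by (auto simp: le_fun_def intro: order_trans)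
    then show "p z \<le> f z" using neg[of z] by simp
  qed
  ultimately show thesis by (rule that)
qed

section \<open>Separation of a convex set from a point\<close>

text \<open>For a convex set, one positive multiple in each direction entails all smaller ones, so
  on convex sets this is the usual notion.\<close>

definition absorbing :: "'a::real_vector set \<Rightarrow> bool" where
  "absorbing V \<longleftrightarrow> (\<forall>x. \<exists>t>0. t *\<^sub>R x \<in> V)"

lemma absorbing_zero: "absorbing V \<Longrightarrow> 0 \<in> V"
  by (auto simp: absorbing_def dest: spec[of _ 0])

lemma convex_scaleR_mem:
  assumes "convex D" "0 \<in> D" "x \<in> D" "0 \<le> t" "t \<le> 1"
  shows "t *\<^sub>R x \<in> D"
  using convexD[OF assms(1,3,2), of t "1 - t"] assms by simp

text \<open>\<open>p\<close> is the Minkowski gauge of D. Absorption makes it finite and convexity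
  makes it subadditive. If x / t were in D for some t < 1, then x = t (x / t) would be in D as well,
  whence the bound outside D.\<close>

lemma gauge_sublinear:
  fixes D :: "'a::real_vector set"
  assumes D: "convex D" "absorbing D"
  obtains p where "sublinear p" "\<And>x. x \<in> D \<Longrightarrow> p x \<le> 1" "\<And>x. x \<notin> D \<Longrightarrow> p x \<ge> 1"
proof -
  define A where "A x = {t. t > 0 \<and> (1 / t) *\<^sub>R x \<in> D}" for x
  define p where "p x = Inf (A x)" for x
  have ne: "A x \<noteq> {}" for x
  proof -
    obtain t where "t > 0" "t *\<^sub>R x \<in> D" using D(2) by (auto simp: absorbing_def)
    then have "1 / t \<in> A x" by (simp add: A_def)
    then show ?thesis by blast
  qed
  have bdd: "bdd_below (A x)" for x
    by (rule bdd_belowI[of _ 0]) (simp add: A_def)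
  have upper: "p x \<le> t" if "t > 0" "(1 / t) *\<^sub>R x \<in> D" for x t
    unfolding p_def using bdd that by (intro cInf_lower) (auto simp: A_def)
  have greatest: "m \<le> p x" if "\<And>t. t > 0 \<Longrightarrow> (1 / t) *\<^sub>R x \<in> D \<Longrightarrow> m \<le> t" for m x
    unfolding p_def using ne that by (intro cInf_greatest) (auto simp: A_def)
  have "sublinear p"
  proof (rule sublinearI)
    fix x y
    have two: "p (x + y) \<le> t + u"
      if t: "t > 0" "(1 / t) *\<^sub>R x \<in> D" and u: "u > 0" "(1 / u) *\<^sub>R y \<in> D" for t u
    proof (rule upper)
      \<comment> \<open>(x + y) / (t + u) is the convex combination of x / t and y / u with these
        weights.\<close>
      have "(t / (t + u)) *\<^sub>R (1 / t) *\<^sub>R x + (u / (t + u)) *\<^sub>R (1 / u) *\<^sub>R y \<in> D"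
        using t u by (intro convexD[OF D(1)]) (auto simp flip: add_divide_distrib)
      then show "(1 / (t + u)) *\<^sub>R (x + y) \<in> D"
        using t u by (simp add: scaleR_add_right)
    qed (use t u in simp)
    have "p (x + y) - u \<le> p x" if "u > 0" "(1 / u) *\<^sub>R y \<in> D" for u
      using two[OF _ _ that] by (intro greatest) (simp add: algebra_simps)
    then have "p (x + y) - p x \<le> p y"
      by (intro greatest) (simp add: algebra_simps)
    then show "p (x + y) \<le> p x + p y" by simp
  next
    fix c :: real and x
    assume c: "c > 0"
    have "p (c *\<^sub>R x) / c \<le> p x"
    proof (rule greatest)
      fix t :: real assume "t > 0" "(1 / t) *\<^sub>R x \<in> D"
      then have "p (c *\<^sub>R x) \<le> c * t" using c by (intro upper) auto
      then show "p (c *\<^sub>R x) / c \<le> t" using c by (simp add: field_simps)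
    qed
    then show "p (c *\<^sub>R x) \<le> c * p x" using c by (simp add: field_simps)
  qed
  moreover have "p x \<le> 1" if "x \<in> D" for x using upper[of 1 x] that by simp
  moreover have "p x \<ge> 1" if "x \<notin> D" for x
  proof (rule greatest, rule ccontr)
    fix t :: real assume t: "t > 0" "(1 / t) *\<^sub>R x \<in> D" "\<not> 1 \<le> t"
    have "t *\<^sub>R (1 / t) *\<^sub>R x \<in> D"
      using convex_scaleR_mem[OF D(1) absorbing_zero[OF D(2)] t(2), of t] t by simp
    then show False using t that by simp
  qed
  ultimately show thesis by (rule that)
qed

text \<open>A linear functional below the gauge of K - V - k0 that attains it at z - k0 separates z
  from K. The lower bound on V is recorded because it later yields continuity, or dependence on
  finitely many coordinates.\<close>

lemma convex_point_separation:
  fixes K :: "'a::real_vector set"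
  assumes K: "convex K" "K \<noteq> {}" and V: "convex V" "absorbing V"
    and disj: "\<And>v. v \<in> V \<Longrightarrow> z + v \<notin> K"
  obtains f :: "'a \<Rightarrow> real" and \<kappa> M where "linear f" "\<And>k. k \<in> K \<Longrightarrow> f k \<le> \<kappa>" "\<kappa> < f z"
    "\<And>v. v \<in> V \<Longrightarrow> - M \<le> f v"
proof -
  obtain k0 where k0: "k0 \<in> K" using K by blast
  \<comment> \<open>Translating by a point of K puts - V inside D, so D inherits absorption from
    V.\<close>
  define D where "D = (\<lambda>y. y - k0) ` {k - v |k v. k \<in> K \<and> v \<in> V}"
  have D: "k - v - k0 \<in> D" if "k \<in> K" "v \<in> V" for k v
    using that by (auto simp: D_def)
  have "convex {k - v |k v. k \<in> K \<and> v \<in> V}"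
  proof -
    have "{k - v |k v. k \<in> K \<and> v \<in> V} = (\<Union>k\<in>K. \<Union>v\<in>V. {k - v})" by auto
    then show ?thesis using convex_differences[OF K(1) V(1)] by simp
  qed
  then have cD: "convex D"
    unfolding D_def by (rule convex_translation_subtract)
  have aD: "absorbing D"
    unfolding absorbing_def
  proof
    fix x
    obtain t where t: "t > 0" "t *\<^sub>R (- x) \<in> V" using V(2) unfolding absorbing_def by blast
    then show "\<exists>t>0. t *\<^sub>R x \<in> D" using D[OF k0 t(2)] by auto
  qed
  define w where "w = z - k0"
  have "w \<notin> D"
  proof
    assume "w \<in> D"
    then obtain k v where kv: "k \<in> K" "v \<in> V" "z = k - v" by (auto simp: D_def w_def)
    then show False using disj[of v] by simp
  qed
  obtain p where p: "sublinear p" "\<And>x. x \<in> D \<Longrightarrow> p x \<le> 1" "\<And>x. x \<notin> D \<Longrightarrow> p x \<ge> 1"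
    using gauge_sublinear[OF cD aD] by blast
  obtain f where f: "linear f" "f \<le> p" "f w = p w"
    using sublinear_dominates_linear[OF p(1)] by blast
  interpret linear f by fact
  have w1: "f w \<ge> 1" using p(3)[OF \<open>w \<notin> D\<close>] f by simp
  have le: "f k - f v \<le> f z" if "k \<in> K" "v \<in> V" for k v
  proof -
    have "f (k - v - k0) \<le> 1"
      using f(2) p(2)[OF D[OF that]] by (auto simp: le_fun_def intro: order_trans)
    then show ?thesis using w1 by (simp add: w_def diff)
  qed
  \<comment> \<open>Strictness comes from this element of V, on which f is negative; inserting it
    into \<open>le\<close> opens a gap of size \<open>t * f w\<close>.\<close>
  obtain t where t: "t > 0" "t *\<^sub>R (- w) \<in> V" using V(2) unfolding absorbing_def by blast
  have ft: "f (t *\<^sub>R (- w)) = - (t * f w)" by (simp add: scale neg)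
  show thesis
  proof (rule that[of f "f z - t * f w" "f z - f k0"])
    show "f k \<le> f z - t * f w" if "k \<in> K" for k
      using le[OF that t(2)] unfolding ft by simp
    show "f z - t * f w < f z" using t w1 by simp
    show "- (f z - f k0) \<le> f v" if "v \<in> V" for v
      using le[OF k0 that] by simp
  qed fact
qed

section \<open>Locally convex spaces\<close>

lemma tendsto_scaleR_lc:
  fixes g :: "'b \<Rightarrow> 'a::locally_convex_t2_space"
  assumes "(f \<longlongrightarrow> c) A" "(g \<longlongrightarrow> x) A"
  shows "((\<lambda>t. f t *\<^sub>R g t) \<longlongrightarrow> c *\<^sub>R x) A"
  using filterlim_compose[OF tendsto_scaleR_Pair filterlim_Pair[OF assms]] by simp

lemma absorbing_open:
  fixes U :: "'a::locally_convex_t2_space set"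
  assumes "open U" "0 \<in> U"
  shows "absorbing U"
  unfolding absorbing_def
proof
  fix x :: 'a
  have "((\<lambda>t. t *\<^sub>R x) \<longlongrightarrow> 0 *\<^sub>R x) (at_right (0::real))"
    by (intro tendsto_scaleR_lc tendsto_ident_at tendsto_const)
  then have "\<forall>\<^sub>F t in at_right (0::real). t *\<^sub>R x \<in> U"
    using assms by (intro topological_tendstoD) auto
  moreover have "\<forall>\<^sub>F t in at_right (0::real). t > 0"
    by (simp add: eventually_at_right_less)
  ultimately have "\<forall>\<^sub>F t in at_right (0::real). t > 0 \<and> t *\<^sub>R x \<in> U"
    by eventually_elim simp
  then show "\<exists>t>0. t *\<^sub>R x \<in> U"
    using eventually_happens' trivial_limit_at_right_real by blast
qed

text \<open>A one-sided bound suffices: applied to both c (y - x) and c (x - y) it controls the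
  absolute value of f y - f x by N / c.\<close>

lemma bounded_below_imp_topological_dual:
  fixes f :: "'a::locally_convex_t2_space \<Rightarrow> real"
  assumes f: "linear f" and U: "open U" "0 \<in> U" and M: "\<And>u. u \<in> U \<Longrightarrow> - M \<le> f u"
  shows "f \<in> topological_dual"
proof -
  interpret linear f by fact
  define N where "N = max M 1"
  have N: "N > 0" "\<And>u. u \<in> U \<Longrightarrow> - N \<le> f u" using M by (force simp: N_def)+
  have "(f \<longlongrightarrow> f x) (at x)" for x
  proof (rule tendstoI)
    fix e :: real assume e: "e > 0"
    \<comment> \<open>This scale turns the bound N into e / 2.\<close>
    define c where "c = 2 * N / e"
    have "((\<lambda>y. c *\<^sub>R (y - x)) \<longlongrightarrow> c *\<^sub>R (x - x)) (at x)"
      by (intro tendsto_scaleR_lc tendsto_ident_at tendsto_const tendsto_diff)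
    then have "\<forall>\<^sub>F y in at x. c *\<^sub>R (y - x) \<in> U"
      using U by (intro topological_tendstoD) auto
    moreover have "((\<lambda>y. c *\<^sub>R (x - y)) \<longlongrightarrow> c *\<^sub>R (x - x)) (at x)"
      by (intro tendsto_scaleR_lc tendsto_ident_at tendsto_const tendsto_diff)
    then have "\<forall>\<^sub>F y in at x. c *\<^sub>R (x - y) \<in> U"
      using U by (intro topological_tendstoD) auto
    ultimately show "\<forall>\<^sub>F y in at x. dist (f y) (f x) < e"
    proof eventually_elim
      case (elim y)
      have "- N \<le> c * (f y - f x)" "- N \<le> c * (f x - f y)"
        using N(2)[OF elim(1)] N(2)[OF elim(2)] by (simp_all add: scale diff)
      then have "c * \<bar>f y - f x\<bar> \<le> N" by (auto simp: abs_if algebra_simps)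
      then have "\<bar>f y - f x\<bar> \<le> e / 2"
        using N e by (simp add: c_def field_simps)
      then show ?case using e by (simp add: dist_real_def)
    qed
  qed
  then show ?thesis
    using f by (auto simp: topological_dual_def continuous_on_def intro: tendsto_within_subset)
qed

lemma topological_dual_linear: "f \<in> topological_dual \<Longrightarrow> linear f"
  by (simp add: topological_dual_def)

lemma topological_dual_axpy:
  assumes "f \<in> topological_dual" "g \<in> topological_dual"
  shows "(\<lambda>x. u * f x + v * g x) \<in> topological_dual"
proof -
  have "linear (\<lambda>x. u * f x + v * g x)"
    using assms
    by (intro linearI) (simp_all add: topological_dual_def linear_add linear_scale algebra_simps)
  then show ?thesis
    using assms by (auto simp: topological_dual_def intro!: continuous_intros)
qed

section \<open>Fenchel conjugates\<close>

lemma ereal_minus_le_iff_le: "ereal b - y \<le> ereal s \<longleftrightarrow> ereal (b - s) \<le> y"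
  by (cases y) auto

text \<open>Real upper bounds r of y turn conjugate inequalities into real inequalities over the
  epigraph. For y = -\<infinity> both sides fail, since r is arbitrarily small.\<close>

lemma ereal_minus_le_iff_all: "ereal b - y \<le> ereal s \<longleftrightarrow> (\<forall>r. y \<le> ereal r \<longrightarrow> b - r \<le> s)"
proof (cases y)
  case MInf
  have False if "\<forall>r. b - r \<le> s"
    using spec[OF that, of "b - s - 1"] by simp
  then show ?thesis using MInf by auto
qed auto

lemma fenchel_conj_le_iff:
  "fenchel_conj h a \<le> ereal s \<longleftrightarrow> (\<forall>x r. h x \<le> ereal r \<longrightarrow> a x - r \<le> s)"
  by (simp add: fenchel_conj_def SUP_le_iff ereal_minus_le_iff_all)

lemma fenchel_conj2_le_iff:
  "fenchel_conj2 F (a, m) \<le> ereal s \<longleftrightarrow> (\<forall>x y. ereal (a x + m y - s) \<le> F (x, y))"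
  by (simp add: fenchel_conj2_def SUP_le_iff ereal_minus_le_iff_le)

lemma fenchel_biconj2_le_iff:
  "fenchel_biconj2 F (x, y) \<le> ereal k \<longleftrightarrow>
    (\<forall>a\<in>topological_dual. \<forall>m\<in>topological_dual. \<forall>s.
      fenchel_conj2 F (a, m) \<le> ereal s \<longrightarrow> a x + m y - s \<le> k)"
  by (auto simp: fenchel_biconj2_def SUP_le_iff ereal_minus_le_iff_all)

section \<open>Affine minorants and the Fenchel-Moreau theorem\<close>

text \<open>Lower semicontinuity provides an open box around (x0, c) that misses the epigraph. The
  box also bounds g on a neighbourhood of 0, hence g is continuous.\<close>

lemma epigraph_separation:
  fixes h :: "'a::locally_convex_t2_space \<Rightarrow> ereal"
  assumes h: "proper_fun h" "convex_fun h" "lsc_fun h" and c: "ereal c < h x0"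
  obtains g \<beta> \<kappa> where "g \<in> topological_dual" "\<beta> \<le> 0"
    "\<And>x r. h x \<le> ereal r \<Longrightarrow> g x + \<beta> * r \<le> \<kappa>" "\<kappa> < g x0 + \<beta> * c"
proof -
  \<comment> \<open>The distance from c to an intermediate level c1 is the vertical half-width of
    the box.\<close>
  obtain c1 where c1: "ereal c < ereal c1" "ereal c1 < h x0" using ereal_dense2[OF c] by blast
  define d where "d = c1 - c"
  have d: "d > 0" using c1 by (simp add: d_def)
  have "\<forall>\<^sub>F y in nhds x0. ereal c1 < h y" using h(3) c1 by (auto simp: lsc_fun_def)
  then obtain W where W: "open W" "x0 \<in> W" "\<And>y. y \<in> W \<Longrightarrow> ereal c1 < h y"
    by (auto simp: eventually_nhds)
  have "((\<lambda>u. x0 + u) \<longlongrightarrow> x0 + 0) (nhds 0)"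
    by (intro tendsto_add tendsto_const filterlim_ident)
  then have "\<forall>\<^sub>F u in nhds 0. x0 + u \<in> W"
    using W by (intro topological_tendstoD) auto
  then obtain U0 where U0: "open U0" "0 \<in> U0" "\<And>u. u \<in> U0 \<Longrightarrow> x0 + u \<in> W"
    by (auto simp: eventually_nhds)
  obtain U where U: "open U" "convex U" "0 \<in> U" "U \<subseteq> U0"
    using locally_convex[OF U0(1,2)] by blast
  define V where "V = U \<times> {- d<..<d}"
  have "convex V" using U by (auto simp: V_def intro: convex_Times)
  have "absorbing V"
    unfolding absorbing_def
  proof
    fix w :: "'a \<times> real"
    obtain t where t: "t > 0" "t *\<^sub>R fst w \<in> U"
      using absorbing_open[OF U(1,3)] by (auto simp: absorbing_def)
    \<comment> \<open>The factor u keeps the first coordinate in U and pushes the second below d;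
      the summand 1 makes the latter strict.\<close>
    define u where "u = min 1 (d / (t * (\<bar>snd w\<bar> + 1)))"
    have u: "u > 0" "u \<le> 1" using t d by (auto simp: u_def)
    have "u *\<^sub>R t *\<^sub>R fst w \<in> U"
      using convex_scaleR_mem[OF U(2,3) t(2)] u by simp
    moreover have "\<bar>u * (t * snd w)\<bar> < d"
    proof -
      have "u * (t * (\<bar>snd w\<bar> + 1)) \<le> d"
        using t by (subst pos_le_divide_eq[symmetric]) (simp_all add: u_def add_nonneg_pos)
      moreover have "\<bar>u * (t * snd w)\<bar> < u * (t * (\<bar>snd w\<bar> + 1))"
        using t u by (simp add: abs_mult)
      ultimately show ?thesis by linarith
    qed
    ultimately have "(u * t) *\<^sub>R w \<in> V"
      by (auto simp: V_def mem_Times_iff abs_less_iff algebra_simps)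
    then show "\<exists>t>0. t *\<^sub>R w \<in> V" using t u by (intro exI[of _ "u * t"]) simp
  qed
  define E where "E = {(x, r). h x \<le> ereal r}"
  have "convex E" using h(2) by (simp add: E_def convex_fun_def)
  obtain x1 r1 where x1: "h x1 = ereal r1"
  proof -
    obtain x1 where "h x1 \<noteq> \<infinity>" using h(1) by (auto simp: proper_fun_def)
    moreover have "h x1 \<noteq> - \<infinity>" using h(1) by (auto simp: proper_fun_def)
    ultimately show thesis using that by (cases "h x1") auto
  qed
  have "E \<noteq> {}" using x1 by (auto simp: E_def intro!: exI[of _ x1] exI[of _ r1])
  have disj: "(x0, c) + v \<notin> E" if "v \<in> V" for v
  proof
    assume "(x0, c) + v \<in> E"
    then have "h (x0 + fst v) \<le> ereal (c + snd v)" by (cases v) (simp add: E_def)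
    also have "c + snd v < c1" using that by (auto simp: V_def d_def)
    finally have "h (x0 + fst v) < ereal c1" by simp
    moreover have "ereal c1 < h (x0 + fst v)" using that U W U0 by (auto simp: V_def)
    ultimately show False by simp
  qed
  obtain f :: "_ \<Rightarrow> real" and \<kappa> M where f: "linear f" "\<And>k. k \<in> E \<Longrightarrow> f k \<le> \<kappa>" "\<kappa> < f (x0, c)"
    "\<And>v. v \<in> V \<Longrightarrow> - M \<le> f v"
    using convex_point_separation[OF \<open>convex E\<close> \<open>E \<noteq> {}\<close> \<open>convex V\<close> \<open>absorbing V\<close> disj]
    by blast
  interpret linear f by fact
  define g where "g x = f (x, 0)" for x
  define \<beta> where "\<beta> = f (0, 1)"
  have split: "f (x, r) = g x + \<beta> * r" for x r
    using add[of "(x, 0)" "(0, r)"] scale[of r "(0, 1)"] by (simp add: g_def \<beta>_def)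
  have "linear g"
  proof (rule linearI)
    show "g (x + y) = g x + g y" for x y using add[of "(x, 0)" "(y, 0)"] by (simp add: g_def)
    show "g (k *\<^sub>R x) = k *\<^sub>R g x" for k x using scale[of k "(x, 0)"] by (simp add: g_def)
  qed
  then have g: "g \<in> topological_dual"
  proof (rule bounded_below_imp_topological_dual[OF _ U(1,3)])
    show "- M \<le> g u" if "u \<in> U" for u
      using f(4)[of "(u, 0)"] that d by (simp add: V_def g_def)
  qed
  have E: "g x + \<beta> * r \<le> \<kappa>" if "h x \<le> ereal r" for x r
    using f(2)[of "(x, r)"] that by (simp add: E_def split)
  have "\<beta> \<le> 0"
  proof (rule ccontr)
    assume "\<not> \<beta> \<le> 0"
    \<comment> \<open>High enough on the vertical ray over x1, a positive \<beta> would violate the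
      bound \<kappa>.\<close>
    define r where "r = max r1 ((\<kappa> - g x1) / \<beta> + 1)"
    have "g x1 + \<beta> * r \<le> \<kappa>" using x1 by (intro E) (simp add: r_def)
    moreover have "\<beta> * r \<ge> \<beta> * ((\<kappa> - g x1) / \<beta> + 1)"
      using \<open>\<not> \<beta> \<le> 0\<close> by (intro mult_left_mono) (auto simp: r_def)
    moreover have "\<beta> * ((\<kappa> - g x1) / \<beta> + 1) = \<kappa> - g x1 + \<beta>"
      using \<open>\<not> \<beta> \<le> 0\<close> by (simp add: distrib_left)
    ultimately show False using \<open>\<not> \<beta> \<le> 0\<close> by linarith
  qed
  then show thesis using that g E f(3) unfolding split by blast
qed

text \<open>Dividing by - \<beta> > 0 turns the separating hyperplane into the graph of an affine
  function; its translate through (x0, c) minorizes h.\<close>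

lemma nonvertical_minorant:
  assumes g: "g \<in> topological_dual" "\<And>x r. h x \<le> ereal r \<Longrightarrow> g x + \<beta> * r \<le> \<kappa>"
    "\<kappa> < g x0 + \<beta> * c" and \<beta>: "\<beta> < 0"
  shows "\<exists>a\<in>topological_dual. fenchel_conj h a \<le> ereal (a x0 - c)"
proof
  \<comment> \<open>The zero summand only matches the shape of
    \<open>topological_dual_axpy\<close>.\<close>
  define a where "a x = (- 1 / \<beta>) * g x + 0 * g x" for x
  show "a \<in> topological_dual"
    unfolding a_def using g(1) by (rule topological_dual_axpy[OF g(1)])
  have "a x - r \<le> a x0 - c" if "h x \<le> ereal r" for x r
  proof -
    have "g x + \<beta> * r \<le> g x0 + \<beta> * c" using g(2)[OF that] g(3) by linarith
    then have "(g x + \<beta> * r) / - \<beta> \<le> (g x0 + \<beta> * c) / - \<beta>"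
      using \<beta> by (intro divide_right_mono) auto
    then show ?thesis using \<beta> by (simp add: a_def diff_divide_distrib add_divide_distrib)
  qed
  then show "fenchel_conj h a \<le> ereal (a x0 - c)" by (simp add: fenchel_conj_le_iff)
qed

text \<open>The conclusion says that the affine function with slope a and value c at x0 minorizes h.
  If the separating hyperplane is vertical, a large multiple of g - \<kappa>, which is nonpositive
  where h < \<infinity> and positive at x0, is added to some other affine minorant.\<close>

theorem fenchel_moreau:
  fixes h :: "'a::locally_convex_t2_space \<Rightarrow> ereal"
  assumes h: "proper_fun h" "convex_fun h" "lsc_fun h" and c: "ereal c < h x0"
  shows "\<exists>a\<in>topological_dual. fenchel_conj h a \<le> ereal (a x0 - c)"
proof -
  obtain g \<beta> \<kappa> where g: "g \<in> topological_dual" "\<beta> \<le> 0"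
    "\<And>x r. h x \<le> ereal r \<Longrightarrow> g x + \<beta> * r \<le> \<kappa>" "\<kappa> < g x0 + \<beta> * c"
    using epigraph_separation[OF h c] by blast
  show ?thesis
  proof (cases "\<beta> < 0")
    case True
    then show ?thesis using nonvertical_minorant[OF g(1,3,4)] by blast
  next
    case False
    then have b0: "\<beta> = 0" using g(2) by simp
    obtain x1 where "h x1 \<noteq> \<infinity>" using h(1) by (auto simp: proper_fun_def)
    moreover have "h x1 \<noteq> - \<infinity>" using h(1) by (auto simp: proper_fun_def)
    ultimately obtain r1 where x1: "h x1 = ereal r1" by (cases "h x1") auto
    have "ereal (r1 - 1) < h x1" by (simp add: x1)
    then obtain g' \<beta>' \<kappa>' where g': "g' \<in> topological_dual" "\<beta>' \<le> 0"
      "\<And>x r. h x \<le> ereal r \<Longrightarrow> g' x + \<beta>' * r \<le> \<kappa>'" "\<kappa>' < g' x1 + \<beta>' * (r1 - 1)"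
      using epigraph_separation[OF h, of "r1 - 1" x1] by blast
    \<comment> \<open>The point (x1, r1) lies in the epigraph directly above the separated point, so
      the hyperplane cannot be vertical.\<close>
    have "\<beta>' \<noteq> 0" using g'(3)[of x1 r1] g'(4) x1 by auto
    then obtain a1 where a1: "a1 \<in> topological_dual"
      and "fenchel_conj h a1 \<le> ereal (a1 x1 - (r1 - 1))"
      using nonvertical_minorant[OF g'(1,3,4)] g'(2) by force
    then obtain s where s: "\<And>x r. h x \<le> ereal r \<Longrightarrow> a1 x - r \<le> s"
      by (auto simp: fenchel_conj_le_iff)
    \<comment> \<open>The least t \<ge> 0 for which a1 - s + t (g - \<kappa>) reaches c at
      x0.\<close>
    define t where "t = max 0 ((s - a1 x0 + c) / (g x0 - \<kappa>))"
    have pos: "g x0 - \<kappa> > 0" using g(4) b0 by simp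
    have "(s - a1 x0 + c) / (g x0 - \<kappa>) \<le> t" by (simp add: t_def)
    then have "s - a1 x0 + c \<le> t * (g x0 - \<kappa>)"
      using pos by (simp only: pos_divide_le_eq)
    then have t: "t \<ge> 0" "s - a1 x0 + c \<le> t * (g x0 - \<kappa>)" by (simp_all add: t_def)
    \<comment> \<open>Adding a multiple of the vertical separating functional lifts the minorant \<open>a1\<close> at \<open>x0\<close>.\<close>
    define a where "a x = 1 * a1 x + t * g x" for x
    have "a x - r \<le> a x0 - c" if "h x \<le> ereal r" for x r
    proof -
      have "t * g x \<le> t * \<kappa>" using g(3)[OF that] t b0 by (intro mult_left_mono) auto
      then show ?thesis using s[OF that] t(2) by (simp add: a_def algebra_simps)
    qed
    moreover have "a \<in> topological_dual"
      unfolding a_def using a1 g(1) by (rule topological_dual_axpy)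
    ultimately show ?thesis by (auto simp: fenchel_conj_le_iff)
  qed
qed

section \<open>Separation in the weak* topology\<close>

text \<open>With pointwise scaling, functionals paired with reals live in the vector space of all
  real functions times the reals, where algebraic separation applies; the dual is a subset of
  it.\<close>

instantiation "fun" :: (type, real_vector) real_vector
begin

definition scaleR_fun :: "real \<Rightarrow> ('a \<Rightarrow> 'b) \<Rightarrow> 'a \<Rightarrow> 'b" where
  "scaleR_fun c f = (\<lambda>x. c *\<^sub>R f x)"

instance
  by standard (simp_all add: scaleR_fun_def fun_eq_iff scaleR_add_right scaleR_add_left)

end

text \<open>A basic open set of the product topology restricts only finitely many coordinates, so
  one common radius works.\<close>

lemma weak_star_neighbourhood:
  assumes "openin weak_star U" "a \<in> U"
  obtains S e where "finite S" "e > 0"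
    "\<And>a'. a' \<in> topological_dual \<Longrightarrow> (\<And>x. x \<in> S \<Longrightarrow> \<bar>a' x - a x\<bar> < e) \<Longrightarrow> a' \<in> U"
proof -
  obtain T where T: "openin (powertop_real UNIV) T" "U = T \<inter> topological_dual"
    using assms(1) by (auto simp: weak_star_def openin_subtopology)
  then obtain W where W: "a \<in> (\<Pi>\<^sub>E i\<in>UNIV. W i)" "\<And>i. open (W i)"
      "finite {i. W i \<noteq> UNIV}" "(\<Pi>\<^sub>E i\<in>UNIV. W i) \<subseteq> T"
    using product_topology_open_contains_basis[OF T(1), of a] assms(2) by auto
  define S where "S = {i. W i \<noteq> UNIV}"
  have "\<exists>e>0. \<forall>y. \<bar>y - a i\<bar> < e \<longrightarrow> y \<in> W i" for i
    using W(2)[of i] W(1) by (auto simp: open_dist dist_real_def PiE_iff)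
  then obtain d where d: "\<And>i. d i > 0" "\<And>i y. \<bar>y - a i\<bar> < d i \<Longrightarrow> y \<in> W i" by metis
  \<comment> \<open>Inserting 1 keeps the minimum defined when S is empty.\<close>
  define e where "e = Min (insert 1 (d ` S))"
  have fin: "finite S" using W(3) by (simp add: S_def)
  show thesis
  proof
    show "finite S" by fact
    show "e > 0" using fin d(1) by (auto simp: e_def)
    show "a' \<in> U" if a': "a' \<in> topological_dual" "\<And>x. x \<in> S \<Longrightarrow> \<bar>a' x - a x\<bar> < e" for a'
    proof -
      have "a' i \<in> W i" for i
      proof (cases "i \<in> S")
        case True
        then have "e \<le> d i" using fin by (auto simp: e_def)
        then show ?thesis using a'(2)[OF True] by (intro d(2)) simp
      qed (simp add: S_def)
      then show ?thesis using W(4) T(2) a'(1) by (auto simp: PiE_iff)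
    qed
  qed
qed

text \<open>Boundedness forces \<open>f (g, 0) = 0\<close> whenever \<open>g\<close> vanishes on \<open>S\<close>; hence \<open>f (g, 0)\<close> is a
  linear combination of the values of \<open>g\<close> on \<open>S\<close>.\<close>

lemma linear_bounded_below_on_box:
  fixes f :: "('a::real_vector \<Rightarrow> real) \<times> real \<Rightarrow> real"
  assumes f: "linear f" and S: "finite S" and e: "e > 0"
    and M: "\<And>g r. (\<And>x. x \<in> S \<Longrightarrow> \<bar>g x\<bar> < e) \<Longrightarrow> \<bar>r\<bar> < e \<Longrightarrow> - M \<le> f (g, r)"
  obtains z b where "\<And>g r. linear g \<Longrightarrow> f (g, r) = g z + b * r"
proof -
  interpret linear f by fact
  have vanish: "f (g, 0) = 0" if g: "\<And>x. x \<in> S \<Longrightarrow> g x = 0" for g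
  proof (rule ccontr)
    assume ne: "f (g, 0) \<noteq> 0"
    \<comment> \<open>The multiple c g still vanishes on S, but f takes a value below - M
      there.\<close>
    define c where "c = - (\<bar>M\<bar> + 1) / f (g, 0)"
    have "- M \<le> f (c *\<^sub>R g, 0)" using g e by (intro M) (auto simp: scaleR_fun_def)
    also have "f (c *\<^sub>R g, 0) = - (\<bar>M\<bar> + 1)" using scale[of c "(g, 0)"] ne by (simp add: c_def)
    finally show False by simp
  qed
  define \<delta> where "\<delta> x = (\<lambda>y::'a. if y = x then 1 else 0 :: real)" for x
  define z where "z = (\<Sum>x\<in>S. f (\<delta> x, 0) *\<^sub>R x)"
  have sum0: "(\<Sum>x\<in>T. (g x *\<^sub>R \<delta> x, 0)) = (\<lambda>y. if y \<in> T then g y else 0, 0 :: real)"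
    if "finite T" for T and g :: "'a \<Rightarrow> real"
    using that by induction (auto simp: zero_prod_def zero_fun_def plus_fun_def scaleR_fun_def \<delta>_def fun_eq_iff)
  have "f (g, r) = g z + f (0, 1) * r" if g: "linear g" for g r
  proof -
    \<comment> \<open>g splits into a part vanishing on S, which f kills, and a combination of
      indicators of points of S.\<close>
    have "f (g, 0) = f (\<lambda>y. if y \<in> S then 0 else g y, 0) + f (\<Sum>x\<in>S. (g x *\<^sub>R \<delta> x, 0))"
      unfolding sum0[OF S] add[symmetric] by (auto simp: plus_fun_def fun_eq_iff intro!: arg_cong[of _ _ f])
    also have "f (\<lambda>y. if y \<in> S then 0 else g y, 0) = 0" by (rule vanish) simp
    also have "f (\<Sum>x\<in>S. (g x *\<^sub>R \<delta> x, 0)) = (\<Sum>x\<in>S. g x * f (\<delta> x, 0))"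
      unfolding sum using scale[of _ "(\<delta> _, 0)"] by (intro sum.cong) simp_all
    also have "\<dots> = g z"
      by (simp add: z_def linear_sum[OF g] linear_scale[OF g] mult.commute)
    finally have "f (g, 0) = g z" by simp
    moreover have "f (g, r) = f (g, 0) + r *\<^sub>R f (0, 1)"
      unfolding scale[symmetric] add[symmetric] by simp
    ultimately show ?thesis by simp
  qed
  then show thesis by (rule that)
qed

text \<open>This reflects that weak*-continuous functionals are evaluations: a functional bounded
  below on a box over finitely many coordinates acts on linear g as evaluation at a single point
  z.\<close>

lemma weak_star_separation:
  fixes C :: "(('a::locally_convex_t2_space \<Rightarrow> real) \<times> real) set"
  assumes C: "convex C" "C \<noteq> {}" "C \<subseteq> topological_dual \<times> UNIV" and a: "a \<in> topological_dual"
    and cl: "(a, s) \<notin> prod_topology weak_star euclideanreal closure_of C"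
  obtains z b \<kappa> where "\<And>a' s'. (a', s') \<in> C \<Longrightarrow> a' z + b * s' \<le> \<kappa>" "\<kappa> < a z + b * s"
proof -
  obtain W where W: "openin (prod_topology weak_star euclideanreal) W" "(a, s) \<in> W" "W \<inter> C = {}"
    using cl a unfolding in_closure_of by (simp add: disjoint_iff) blast
  then obtain U T where U: "openin weak_star U" "a \<in> U" and T: "open T" "s \<in> T"
    and UT: "U \<times> T \<subseteq> W"
    unfolding openin_prod_topology_alt by (metis open_openin)
  obtain S e1 where S: "finite S" "e1 > 0"
    "\<And>a'. a' \<in> topological_dual \<Longrightarrow> (\<And>x. x \<in> S \<Longrightarrow> \<bar>a' x - a x\<bar> < e1) \<Longrightarrow> a' \<in> U"
    using weak_star_neighbourhood[OF U] by blast
  obtain e2 where e2: "e2 > 0" "\<And>y. \<bar>y - s\<bar> < e2 \<Longrightarrow> y \<in> T"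
    using T by (auto simp: open_dist dist_real_def)
  define e where "e = min e1 e2"
  have e: "e > 0" using S e2 by (simp add: e_def)
  \<comment> \<open>The box lives in the space of all functions, so (a, s) + V may leave the dual.
    Only its points in C matter, and those have their first component in the dual.\<close>
  define V where "V = {(g, r). (\<forall>x\<in>S. \<bar>g x\<bar> < e) \<and> \<bar>r\<bar> < e}"
  have conv: "\<bar>u * p + v * q\<bar> < e"
    if "\<bar>p\<bar> < e" "\<bar>q\<bar> < e" "u \<ge> 0" "v \<ge> 0" "u + v = 1" for u v p q :: real
    using convexD[OF convex_ball[of 0 e], of p q u v] that by (simp add: dist_real_def)
  have "convex V"
    by (rule convexI) (auto simp: V_def scaleR_fun_def conv)
  have "absorbing V"
    unfolding absorbing_def
  proof
    fix w :: "('a \<Rightarrow> real) \<times> real"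
    \<comment> \<open>m strictly exceeds every coordinate constrained by the box, so scaling by e /
      m lands inside it.\<close>
    define m where "m = 1 + \<bar>snd w\<bar> + (\<Sum>x\<in>S. \<bar>fst w x\<bar>)"
    have m: "m > 0" "\<bar>snd w\<bar> < m" by (auto simp: m_def sum_nonneg add_pos_nonneg add_strict_increasing)
    have "\<bar>fst w x\<bar> < m" if "x \<in> S" for x
      using member_le_sum[of x S "\<lambda>x. \<bar>fst w x\<bar>"] that S by (simp add: m_def)
    then have "(e / m) *\<^sub>R w \<in> V"
      using m e by (cases w) (auto simp: V_def scaleR_fun_def abs_mult field_simps)
    then show "\<exists>t>0. t *\<^sub>R w \<in> V" using m e by (intro exI[of _ "e / m"]) simp
  qed
  have disj: "(a, s) + v \<notin> C" if "v \<in> V" for v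
  proof
    assume vC: "(a, s) + v \<in> C"
    then have dual: "a + fst v \<in> topological_dual" using C(3) by (cases v) auto
    have "a + fst v \<in> U"
      using that by (intro S(3)[OF dual]) (auto simp: V_def e_def)
    moreover have "s + snd v \<in> T" using that by (intro e2) (auto simp: V_def e_def)
    ultimately have "(a, s) + v \<in> W" using UT by (cases v) auto
    then show False using W(3) vC by blast
  qed
  obtain f :: "_ \<Rightarrow> real" and \<kappa> M where f: "linear f" "\<And>k. k \<in> C \<Longrightarrow> f k \<le> \<kappa>" "\<kappa> < f (a, s)"
    "\<And>v. v \<in> V \<Longrightarrow> - M \<le> f v"
    using convex_point_separation[OF C(1,2) \<open>convex V\<close> \<open>absorbing V\<close> disj] by blast
  obtain z b where zb: "\<And>g r. linear g \<Longrightarrow> f (g, r) = g z + b * r"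
    using linear_bounded_below_on_box[OF f(1) S(1) e, of M] f(4) by (auto simp: V_def)
  show thesis
  proof
    show "a' z + b * s' \<le> \<kappa>" if aC: "(a', s') \<in> C" for a' s'
    proof -
      have "linear a'" using aC C(3) topological_dual_linear by blast
      then show ?thesis using f(2)[OF aC] by (simp add: zb)
    qed
    show "\<kappa> < a z + b * s"
      using f(3) by (simp add: zb topological_dual_linear[OF a])
  qed
qed

section \<open>The S-procedure\<close>

lemma S_statement_B_imp_A:
  fixes F :: "'x::locally_convex_t2_space \<times> 'y::locally_convex_t2_space \<Rightarrow> ereal"
  assumes h: "proper_fun h" "convex_fun h" "lsc_fun h" and B: "S_statement_B F h"
  shows "S_statement_A F h"
  unfolding S_statement_A_def
proof (rule allI, rule ccontr)
  fix x
  assume "\<not> h x \<le> F (x, 0)"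
  then have "F (x, 0) < h x" by simp
  then obtain c where c: "F (x, 0) < ereal c" "ereal c < h x"
    using ereal_dense2 by blast
  obtain a where a: "a \<in> topological_dual" "fenchel_conj h a \<le> ereal (a x - c)"
    using fenchel_moreau[OF h c(2)] by blast
  then have "a \<in> dom_conj h" by (auto simp: dom_conj_def)
  then obtain m where m: "m \<in> topological_dual" "fenchel_conj2 F (a, m) \<le> fenchel_conj h a"
    using B by (auto simp: S_statement_B_def)
  have "fenchel_conj2 F (a, m) \<le> ereal (a x - c)" using m(2) a(2) by (rule order_trans)
  \<comment> \<open>At y = 0 the functional m vanishes, and the bound reduces to c \<le> F (x,
    0).\<close>
  then have "ereal (a x + m 0 - (a x - c)) \<le> F (x, 0)"
    unfolding fenchel_conj2_le_iff by blast
  then show False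
    using c(1) linear_0[OF topological_dual_linear[OF m(1)]] by simp
qed

section \<open>The projected epigraph of the conjugate and its weak*-closure\<close>

definition conj_epi_projection ::
  "('a::locally_convex_t2_space \<times> 'b::locally_convex_t2_space \<Rightarrow> ereal) \<Rightarrow> (('a \<Rightarrow> real) \<times> real) set"
  where "conj_epi_projection F =
    {(a, s). a \<in> topological_dual \<and> (\<exists>m\<in>topological_dual. fenchel_conj2 F (a, m) \<le> ereal s)}"

text \<open>Elements correspond to affine minorants of F. A convex combination of two minorants is
  at most their maximum, so no arithmetic with extended values of F is involved.\<close>

lemma convex_conj_epi_projection: "convex (conj_epi_projection F)"
proof (rule convexI)
  fix p q :: "('a \<Rightarrow> real) \<times> real" and u v :: real
  assume p: "p \<in> conj_epi_projection F" and q: "q \<in> conj_epi_projection F"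
    and uv: "0 \<le> u" "0 \<le> v" "u + v = 1"
  obtain a s m where a: "p = (a, s)" "a \<in> topological_dual" "m \<in> topological_dual"
    "\<And>x y. ereal (a x + m y - s) \<le> F (x, y)"
    using p by (auto simp: conj_epi_projection_def fenchel_conj2_le_iff)
  obtain b t n where b: "q = (b, t)" "b \<in> topological_dual" "n \<in> topological_dual"
    "\<And>x y. ereal (b x + n y - t) \<le> F (x, y)"
    using q by (auto simp: conj_epi_projection_def fenchel_conj2_le_iff)
  have "ereal ((u * a x + v * b x) + (u * m y + v * n y) - (u * s + v * t)) \<le> F (x, y)" for x y
  proof -
    have "(u * a x + v * b x) + (u * m y + v * n y) - (u * s + v * t)
        = u * (a x + m y - s) + v * (b x + n y - t)" by (simp add: algebra_simps)
    also have "\<dots> \<le> max (a x + m y - s) (b x + n y - t)"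
      using convex_bound_le[of "a x + m y - s" "max (a x + m y - s) (b x + n y - t)"
          "b x + n y - t" u v] uv by simp
    finally have "ereal ((u * a x + v * b x) + (u * m y + v * n y) - (u * s + v * t))
        \<le> max (ereal (a x + m y - s)) (ereal (b x + n y - t))"
      by (simp add: max_def split: if_splits)
    also have "\<dots> \<le> F (x, y)" using a(4) b(4) by simp
    finally show ?thesis .
  qed
  moreover have "u *\<^sub>R p + v *\<^sub>R q = (\<lambda>x. u * a x + v * b x, u * s + v * t)"
    by (simp add: a(1) b(1) scaleR_fun_def plus_fun_def)
  ultimately show "u *\<^sub>R p + v *\<^sub>R q \<in> conj_epi_projection F"
    using topological_dual_axpy[OF a(2) b(2), of u v] topological_dual_axpy[OF a(3) b(3), of u v]
    by (simp add: conj_epi_projection_def fenchel_conj2_le_iff)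
      (rule bexI[of _ "\<lambda>y. u * m y + v * n y"], simp_all)
qed

lemma conj_epi_projection_mono:
  "(a, s) \<in> conj_epi_projection F \<Longrightarrow> s \<le> t \<Longrightarrow> (a, t) \<in> conj_epi_projection F"
  unfolding conj_epi_projection_def using order_trans ereal_less_eq(3) by blast

text \<open>On the slice y = 0 the functional m contributes 0, so the biconjugate there is the
  supremum of a - s over the projected epigraph.\<close>

lemma fenchel_biconj2_zero_le_iff:
  "fenchel_biconj2 F (x, 0) \<le> ereal k \<longleftrightarrow>
    (\<forall>(a, s) \<in> conj_epi_projection F. a x - s \<le> k)"
  by (auto simp: fenchel_biconj2_le_iff conj_epi_projection_def
      linear_0[OF topological_dual_linear])

lemma biconj_minorant_in_closure:
  fixes F :: "'x::locally_convex_t2_space \<times> 'y::locally_convex_t2_space \<Rightarrow> ereal"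
  assumes a: "a \<in> topological_dual"
    and le: "\<And>x. ereal (a x - s) \<le> fenchel_biconj2 F (x, 0)"
    and x0: "fenchel_biconj2 F (x0, 0) \<noteq> \<infinity>"
  shows "(a, s) \<in> prod_topology weak_star euclideanreal closure_of conj_epi_projection F"
proof (rule ccontr)
  let ?C = "conj_epi_projection F"
  assume ncl: "(a, s) \<notin> prod_topology weak_star euclideanreal closure_of ?C"
  \<comment> \<open>An upper bound for all members of \<open>?C\<close> at x bounds the biconjugate,
    hence also a - s.\<close>
  have le': "a x - s \<le> k" if "\<And>a' s'. (a', s') \<in> ?C \<Longrightarrow> a' x - s' \<le> k" for x k
  proof -
    have "fenchel_biconj2 F (x, 0) \<le> ereal k" using that by (auto simp: fenchel_biconj2_zero_le_iff)
    with le[of x] have "ereal (a x - s) \<le> ereal k" by (rule order_trans)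
    then show ?thesis by simp
  qed
  \<comment> \<open>Over an empty set every k is a bound, even one below a 0 - s.\<close>
  have ne: "?C \<noteq> {}" using le'[of 0 "a 0 - s - 1"] by auto
  have "?C \<subseteq> topological_dual \<times> UNIV" by (auto simp: conj_epi_projection_def)
  then obtain z b \<kappa> where z: "\<And>a' s'. (a', s') \<in> ?C \<Longrightarrow> a' z + b * s' \<le> \<kappa>" "\<kappa> < a z + b * s"
    using weak_star_separation[OF convex_conj_epi_projection ne _ a ncl] by blast
  have "b \<le> 0"
  proof (rule ccontr)
    assume b: "\<not> b \<le> 0"
    obtain a' s' where C: "(a', s') \<in> ?C" using ne by auto
    define t where "t = max s' ((\<kappa> - a' z) / b + 1)"
    have "a' z + b * t \<le> \<kappa>"
      using C by (intro z conj_epi_projection_mono[OF C]) (simp add: t_def)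
    moreover have "b * t \<ge> b * ((\<kappa> - a' z) / b + 1)"
      using b by (intro mult_left_mono) (auto simp: t_def)
    moreover have "b * ((\<kappa> - a' z) / b + 1) = \<kappa> - a' z + b"
      using b by (simp add: distrib_left)
    ultimately show False using b by linarith
  qed
  then consider "b < 0" | "b = 0" by linarith
  then show False
  proof cases
    case 1
    \<comment> \<open>Dividing the separating inequality by - b > 0 makes it a bound at w that a - s
      exceeds.\<close>
    define w where "w = (- 1 / b) *\<^sub>R z"
    have scale: "g w = - g z / b" if "g \<in> topological_dual" for g
      unfolding w_def linear_scale[OF topological_dual_linear[OF that]] by simp
    have "a w - s \<le> - \<kappa> / b"
    proof (rule le')
      fix a' s' assume C: "(a', s') \<in> ?C"
      then have "a' \<in> topological_dual" by (simp add: conj_epi_projection_def)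
      moreover have "(a' z + b * s') / - b \<le> \<kappa> / - b"
        using z(1)[OF C] 1 by (intro divide_right_mono) auto
      ultimately show "a' w - s' \<le> - \<kappa> / b"
        using 1 by (simp add: scale add_divide_distrib)
    qed
    moreover have "\<kappa> / - b < (a z + b * s) / - b"
      using z(2) 1 by (intro divide_strict_right_mono) auto
    ultimately show False using 1 by (simp add: scale[OF a] add_divide_distrib)
  next
    case 2
    obtain r where r: "\<And>a' s'. (a', s') \<in> ?C \<Longrightarrow> a' x0 - s' \<le> r"
    proof -
      obtain r where "fenchel_biconj2 F (x0, 0) \<le> ereal r"
        using x0 by (cases "fenchel_biconj2 F (x0, 0)") auto
      then show thesis using that unfolding fenchel_biconj2_zero_le_iff by blast
    qed
    have lin: "g (x0 + t *\<^sub>R z) = g x0 + t * g z" if "g \<in> topological_dual" for g t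
      using topological_dual_linear[OF that] by (simp add: linear_add linear_scale)
    \<comment> \<open>The step is long enough that t (a z - \<kappa>) exceeds r - (a x0 - s),
      whereas \<open>le'\<close> along the ray from x0 forbids this.\<close>
    define t where "t = (\<bar>r - (a x0 - s)\<bar> + 1) / (a z - \<kappa>)"
    have pos: "a z - \<kappa> > 0" using z(2) 2 by simp
    then have "t \<ge> 0" by (simp add: t_def)
    have "a (x0 + t *\<^sub>R z) - s \<le> r + t * \<kappa>"
    proof (rule le')
      fix a' s' assume C: "(a', s') \<in> ?C"
      then have "a' \<in> topological_dual" by (simp add: conj_epi_projection_def)
      moreover have "t * a' z \<le> t * \<kappa>" using z(1)[OF C] 2 \<open>t \<ge> 0\<close> by (intro mult_left_mono) auto
      ultimately show "a' (x0 + t *\<^sub>R z) - s' \<le> r + t * \<kappa>" using r[OF C] by (simp add: lin)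
    qed
    then have "t * (a z - \<kappa>) \<le> r - (a x0 - s)" by (simp add: lin[OF a] algebra_simps)
    then show False using pos by (simp add: t_def)
  qed
qed

theorem corollary4:
  fixes F :: "'x::locally_convex_t2_space \<times> 'y::locally_convex_t2_space \<Rightarrow> ereal"
    and h :: "'x \<Rightarrow> ereal"
  assumes "proper_fun h" and "convex_fun h" and "lsc_fun h"
    and "\<And>a. a \<in> dom_conj h \<Longrightarrow>
           (INF x. F (x, 0) - ereal (a x)) = (INF x. fenchel_biconj2 F (x, 0) - ereal (a x))"
    and "\<And>a. a \<in> dom_conj h \<Longrightarrow>
           (INF x. fenchel_biconj2 F (x, 0) - ereal (a x)) \<noteq> \<infinity>"
    and "closed_regarding (prod_topology weak_star euclideanreal)
           {(a, s). a \<in> topological_dual \<and>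
                    (\<exists>m \<in> topological_dual. fenchel_conj2 F (a, m) \<le> ereal s)}
           (gph_conj h)"
  shows "S_procedure_valid F h"
proof -
  have "S_statement_B F h" if A: "S_statement_A F h"
    unfolding S_statement_B_def
  proof
    fix a assume a: "a \<in> dom_conj h"
    then have dual: "a \<in> topological_dual" and fin: "fenchel_conj h a < \<infinity>"
      by (auto simp: dom_conj_def)
    \<comment> \<open>A point where h is not \<infinity> keeps the conjugate above -\<infinity>, so
      (a, s) is a genuine point of the graph.\<close>
    obtain x1 where "h x1 \<noteq> \<infinity>" using assms(1) by (auto simp: proper_fun_def)
    then have "ereal (a x1) - h x1 \<noteq> - \<infinity>" by (cases "h x1") auto
    moreover have "ereal (a x1) - h x1 \<le> fenchel_conj h a"
      unfolding fenchel_conj_def by (intro SUP_upper) simp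
    ultimately have "fenchel_conj h a \<noteq> - \<infinity>" by auto
    then obtain s where s: "fenchel_conj h a = ereal s" using fin by (cases "fenchel_conj h a") auto
    \<comment> \<open>The Fenchel inequality for h combined with (A); the equality of infima then
      carries the bound over to the biconjugate.\<close>
    have "ereal (- s) \<le> F (x, 0) - ereal (a x)" for x
    proof -
      have "ereal (a x) - h x \<le> ereal s"
        using s unfolding fenchel_conj_def by (metis SUP_upper UNIV_I)
      then have "ereal (a x - s) \<le> h x" by (simp add: ereal_minus_le_iff_le)
      also have "\<dots> \<le> F (x, 0)" using A by (simp add: S_statement_A_def)
      finally show ?thesis by (cases "F (x, 0)") auto
    qed
    then have "ereal (- s) \<le> (INF x. F (x, 0) - ereal (a x))" by (intro INF_greatest)
    then have inf: "ereal (- s) \<le> (INF x. fenchel_biconj2 F (x, 0) - ereal (a x))"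
      using assms(4)[OF a] by simp
    have "ereal (a x - s) \<le> fenchel_biconj2 F (x, 0)" for x
    proof -
      have "ereal (- s) \<le> fenchel_biconj2 F (x, 0) - ereal (a x)"
        using inf by (rule order_trans) (intro INF_lower UNIV_I)
      then show ?thesis by (cases "fenchel_biconj2 F (x, 0)") auto
    qed
    moreover obtain x0 where "fenchel_biconj2 F (x0, 0) \<noteq> \<infinity>"
    proof (rule ccontr)
      assume "\<not> thesis"
      \<comment> \<open>A biconjugate identically \<infinity> on the slice would have infimum
        \<infinity>, which is excluded.\<close>
      then have "fenchel_biconj2 F (x, 0) = \<infinity>" for x using that by blast
      then show False using assms(5)[OF a] by simp
    qed
    ultimately have
      "(a, s) \<in> prod_topology weak_star euclideanreal closure_of conj_epi_projection F"
      by (rule biconj_minorant_in_closure[OF dual])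
    moreover have "(a, s) \<in> gph_conj h" using a s by (simp add: gph_conj_def)
    \<comment> \<open>Relative closedness is applied exactly at the graph point (a, s).\<close>
    ultimately have "(a, s) \<in> conj_epi_projection F"
      using assms(6) unfolding closed_regarding_def conj_epi_projection_def by blast
    then show "\<exists>m\<in>topological_dual. fenchel_conj2 F (a, m) \<le> fenchel_conj h a"
      by (simp add: conj_epi_projection_def s)
  qed
  then show ?thesis
    using S_statement_B_imp_A[OF assms(1-3)] by (auto simp: S_procedure_valid_def)
qed

end
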